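(* Let $p$ be a prime, $q=p^l$, $m\ge1$, $n=2m$. Let $r=\rho(q-1)$ with $0\leqslant\rho\leqslant n-1$ and $\rho=2\rho'$ even, and let $I\subseteq M_r$ with $\{0,2\}\cap I=\{0\}$. Then the minimum weight codewords of $\mathcal{C}_q(r,I,n)^*$ are exactly the vectors $x=(x_g)_{g\in\mathbb{F}_{q^n}^*}$ for which there exist $\lambda\in\mathbb{F}_q^*$ and an $\mathbb{F}_{q^2}$-subspace $V\subseteq\mathbb{F}_{q^n}$ of dimension $m-\rho'$ over $\mathbb{F}_{q^2}$ such that $x_g=\lambda$ for $g\in V\setminus\{0\}$ and $x_g=0$ otherwise.
   Context: Let $N=q^n-1$ and $\alpha$ a primitive element of $\mathbb{F}_{q^n}$. Every integer $0\le u\le q^n-1$ is written $u=\sum_{i=0}^{n-1}u_iq^i$, $u_i\in\{0,\dots,q-1\}$; $\mathrm{wt}_q(u)=\sum u_i$, $O(u)=\sum_{i\text{ odd}}u_i$, $E(u)=\sum_{i\text{ even}}u_i$. For $-1\le r<n(q-1)$, $Z_r=\{\alpha^u\mid 0<u\le q^n-1,\ \mathrm{wt}_q(u)\le n(q-1)-r-1\}$. For $0\le r\le n(q-1)$ and integer $k\ge0$, $\Theta^{(r)}_k=\{\alpha^u\mid 0\le u\le q^n-1,\ \mathrm{wt}_q(u)=n(q-1)-r,\ |O(u)-E(u)|=k\}$. $M_r$ is the set of even (resp. odd) integers $k\in[0,m(q-1)]$ when $r$ is even (resp. odd). For $I\subseteq M_r$: $\overline I=M_r\setminus I$, $Z_{r,I}=Z_r\cup\bigcup_{k\in\overline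 I}\Theta^{(r)}_k$. $\mathcal{C}_q(r,I,n)^*$ is the cyclic code of length $N$ over $\mathbb{F}_q$ with coordinates indexed by $\mathbb{F}_{q^n}^*$ consisting of all $x=(x_g)$ with $\sum_g x_g g^{u}=0$ for every $u\in[1,N]$ with $\alpha^u\in Z_{r,I}$. Minimum weight is Hamming weight. *)

theory Defs
  imports Main "HOL-Computational_Algebra.Primes"
begin

definition digit :: "nat \<Rightarrow> nat \<Rightarrow> nat \<Rightarrow> nat" where
  "digit q u i = (u div q ^ i) mod q"

definition wtq :: "nat \<Rightarrow> nat \<Rightarrow> nat \<Rightarrow> nat" where
  "wtq q n u = (\<Sum>i<n. digit q u i)"

definition Odig :: "nat \<Rightarrow> nat \<Rightarrow> nat \<Rightarrow> nat" where
  "Odig q n u = (\<Sum>i\<in>{i. i < n \<and> odd i}. digit q u i)"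

definition Edig :: "nat \<Rightarrow> nat \<Rightarrow> nat \<Rightarrow> nat" where
  "Edig q n u = (\<Sum>i\<in>{i. i < n \<and> even i}. digit q u i)"

definition Zset :: "nat \<Rightarrow> nat \<Rightarrow> 'a::field \<Rightarrow> nat \<Rightarrow> 'a set" where
  "Zset q n \<alpha> r = {\<alpha> ^ u | u. 0 < u \<and> u \<le> q ^ n - 1 \<and> wtq q n u + r + 1 \<le> n * (q - 1)}"

definition Theta :: "nat \<Rightarrow> nat \<Rightarrow> 'a::field \<Rightarrow> nat \<Rightarrow> nat \<Rightarrow> 'a set" where
  "Theta q n \<alpha> r k = {\<alpha> ^ u | u. u \<le> q ^ n - 1 \<and> int (wtq q n u) = int (n * (q - 1)) - int r
      \<and> \<bar>int (Odig q n u) - int (Edig q n u)\<bar> = int k}"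

definition Mset :: "nat \<Rightarrow> nat \<Rightarrow> nat \<Rightarrow> nat set" where
  "Mset q m r = {k. k \<le> m * (q - 1) \<and> (even k \<longleftrightarrow> even r)}"

definition ZrI :: "nat \<Rightarrow> nat \<Rightarrow> 'a::field \<Rightarrow> nat \<Rightarrow> nat set \<Rightarrow> 'a set" where
  "ZrI q n \<alpha> r I = Zset q n \<alpha> r \<union> (\<Union>k \<in> Mset q (n div 2) r - I. Theta q n \<alpha> r k)"

definition subF :: "nat \<Rightarrow> 'a::field set" where
  "subF q = {y. y ^ q = y}"

(* The code C_q(r,I,n)^*: vectors over F_q indexed by the nonzero field elements,
   represented as functions 'a => 'a with values in F_q and (dummy) value 0 at 0. *)
definition code :: "nat \<Rightarrow> nat \<Rightarrow> 'a::{field,finite} \<Rightarrow> nat \<Rightarrow> nat set \<Rightarrow> ('a \<Rightarrow> 'a) set" where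
  "code q n \<alpha> r I = {x. (\<forall>g. x g \<in> subF q) \<and> x 0 = 0 \<and>
     (\<forall>u\<in>{1..q ^ n - 1}. \<alpha> ^ u \<in> ZrI q n \<alpha> r I \<longrightarrow> (\<Sum>g\<in>{g. g \<noteq> 0}. x g * g ^ u) = 0)}"

definition hwt :: "('a::zero \<Rightarrow> 'a) \<Rightarrow> nat" where
  "hwt x = card {g. g \<noteq> 0 \<and> x g \<noteq> 0}"

definition min_wt_codewords :: "('a::zero \<Rightarrow> 'a) set \<Rightarrow> ('a \<Rightarrow> 'a) set" where
  "min_wt_codewords C = {x \<in> C. x \<noteq> (\<lambda>_. 0) \<and> (\<forall>y\<in>C. y \<noteq> (\<lambda>_. 0) \<longrightarrow> hwt x \<le> hwt y)}"

definition subspace_dim :: "'a::field set \<Rightarrow> 'a set \<Rightarrow> nat \<Rightarrow> bool" where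
  "subspace_dim K V d \<longleftrightarrow> (\<exists>b :: nat \<Rightarrow> 'a.
      V = {(\<Sum>i<d. c i * b i) | c. \<forall>i<d. c i \<in> K} \<and>
      (\<forall>c. (\<forall>i<d. c i \<in> K) \<and> (\<Sum>i<d. c i * b i) = 0 \<longrightarrow> (\<forall>i<d. c i = 0)))"

definition primitive :: "'a::field \<Rightarrow> bool" where
  "primitive \<alpha> \<longleftrightarrow> \<alpha> \<noteq> 0 \<and> (\<forall>x. x \<noteq> 0 \<longrightarrow> (\<exists>k. x = \<alpha> ^ k))"

end

theory Submission
  imports Defs "HOL-Computational_Algebra.Polynomial"
begin

text \<open>
  Put \<open>k = 2 * \<kappa>\<close> with \<open>\<kappa> = m - \<rho>'\<close> and \<open>d = q ^ k - 1\<close>. All exponents in \<open>{1..<d}\<close> have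
  \<open>q\<close>-weight below \<open>k * (q - 1)\<close>, so the BCH bound gives minimum weight at least \<open>d\<close>.

  Power sums of an \<open>F_(q^2)\<close>-subspace \<open>V\<close> of dimension \<open>\<kappa>\<close> expand into sums of products of linear
  maps and maps semilinear for \<open>c \<mapsto> c ^ q\<close> (even and odd digits respectively); these vanish if
  there are fewer than \<open>k * (q - 1)\<close> factors, or exactly that many but not equally many of both
  kinds. As \<open>0 \<in> I\<close>, the indicator of \<open>V - {0}\<close> is a codeword, of weight \<open>d\<close>.

  Conversely, let \<open>x\<close> have weight \<open>d\<close> and let \<open>P\<close> be the monic polynomial whose roots are its
  support. Newton's identities force \<open>X * P\<close> to be a \<open>q\<close>-polynomial, and the zeros coming from
  \<open>2 \<notin> I\<close> remove the coefficients at \<open>X ^ (q ^ s)\<close> with \<open>s\<close> odd, so that the support together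
  with \<open>0\<close> is an \<open>F_(q^2)\<close>-subspace \<open>V\<close>. Subtracting a multiple of the indicator of \<open>V - {0}\<close>
  from \<open>x\<close> gives a codeword of weight less than \<open>d\<close>, which is zero.
\<close>

section \<open>Base-q digits\<close>

lemma sum_digits_mod: "(\<Sum>i<k. digit q u i * q ^ i) = u mod q ^ k"
proof (induction k)
  case (Suc k)
  have "u mod q ^ Suc k = q ^ k * (u div q ^ k mod q) + u mod q ^ k"
    by (metis mod_mult2_eq power_Suc2)
  with Suc show ?case by (simp add: digit_def algebra_simps)
qed simp

lemma digit_sum_powers:
  assumes "\<And>i. i < n \<Longrightarrow> f i < q" "j < n"
  shows "digit q (\<Sum>i<n. f i * q ^ i) j = f j"
  using assms
proof (induction n arbitrary: f j)
  case (Suc n)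
  have *: "(\<Sum>i<Suc n. f i * q ^ i) = f 0 + q * (\<Sum>i<n. f (Suc i) * q ^ i)"
    by (subst sum.lessThan_Suc_shift) (simp add: sum_distrib_left algebra_simps)
  have f0: "f 0 < q" using Suc.prems(1) by simp
  show ?case
  proof (cases j)
    case 0
    then show ?thesis unfolding * using f0 by (simp add: digit_def)
  next
    case (Suc i)
    have "(f 0 + q * S) div q ^ Suc i = S div q ^ i" for S
      using f0 by (simp add: div_mult2_eq)
    then show ?thesis
      unfolding * using Suc Suc.IH[of "\<lambda>i. f (Suc i)" i] Suc.prems
      by (simp add: digit_def)
  qed
qed simp

lemma wtq_sum_powers:
  assumes "\<And>i. i < n \<Longrightarrow> f i < q"
  shows "wtq q n (\<Sum>i<n. f i * q ^ i) = (\<Sum>i<n. f i)"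
  using digit_sum_powers[of n f q] assms by (simp add: wtq_def)

lemma Edig_double: "Edig q (2 * m) u = (\<Sum>i<m. digit q u (2 * i))"
proof -
  have "{i. i < 2 * m \<and> even i} = (\<lambda>i. 2 * i) ` {..<m}"
    by (auto elim!: evenE)
  then show ?thesis by (simp add: Edig_def sum.reindex inj_on_def)
qed

lemma Odig_double: "Odig q (2 * m) u = (\<Sum>i<m. digit q u (2 * i + 1))"
proof -
  have "{i. i < 2 * m \<and> odd i} = (\<lambda>i. 2 * i + 1) ` {..<m}"
    by (auto elim!: oddE)
  then show ?thesis by (simp add: Odig_def sum.reindex inj_on_def)
qed

lemma wtq_eq_Odig_plus_Edig: "wtq q n u = Odig q n u + Edig q n u"
proof -
  have "{..<n} = {i. i < n \<and> odd i} \<union> {i. i < n \<and> even i}" by auto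
  then show ?thesis
    unfolding wtq_def Odig_def Edig_def by (simp only:) (rule sum.union_disjoint; auto)
qed

lemma sum_powers_complement:
  fixes q :: nat
  assumes "q \<ge> 1"
  shows "(\<Sum>i<k. (q - 1) * q ^ i) = q ^ k - 1"
proof (induction k)
  case (Suc k)
  have "q ^ k \<ge> 1" using assms by simp
  moreover have "(q - 1) * q ^ k + q ^ k = q ^ Suc k"
    using assms by (simp add: mult_eq_if)
  ultimately show ?case using Suc by simp
qed simp

lemma digit_less: "q \<ge> 1 \<Longrightarrow> digit q u i < q"
  by (simp add: digit_def)

text \<open>Replacing every digit \<open>c\<close> by \<open>q - 1 - c\<close> subtracts without
  borrowing, so value and weight are complemented together. Questions about nearly maximal weight
  thereby become questions about digit sums near 0.\<close>

lemma digit_complement: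
  assumes "q \<ge> 1" "u < q ^ k"
  shows "(\<Sum>i<k. (q - 1 - digit q u i) * q ^ i) + u = q ^ k - 1"
    and "(\<Sum>i<k. q - 1 - digit q u i) + wtq q k u = k * (q - 1)"
proof -
  have le: "digit q u i \<le> q - 1" for i
    using digit_less[OF assms(1), of u i] by simp
  have "(\<Sum>i<k. (q - 1 - digit q u i) * q ^ i) + (\<Sum>i<k. digit q u i * q ^ i)
      = (\<Sum>i<k. (q - 1) * q ^ i)"
    by (simp only: sum.distrib[symmetric] add_mult_distrib[symmetric] le_add_diff_inverse2[OF le])
  then show "(\<Sum>i<k. (q - 1 - digit q u i) * q ^ i) + u = q ^ k - 1"
    using assms sum_powers_complement[of q k] by (simp only: sum_digits_mod mod_less)
  show "(\<Sum>i<k. q - 1 - digit q u i) + wtq q k u = k * (q - 1)"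
    by (simp only: wtq_def sum.distrib[symmetric] le_add_diff_inverse2[OF le]) simp
qed

text \<open>Natural summands with total at most 1 are all zero or contain a single 1. With
  \<open>w i = q ^ i\<close>, a number of digit sum at most 1 is 0 or a power of
  \<open>q\<close>.\<close>

lemma sum_le_1_cases:
  fixes f :: "nat \<Rightarrow> nat"
  assumes "(\<Sum>i<k. f i) \<le> 1"
  shows "(\<Sum>i<k. f i * w i) = 0 \<or> (\<exists>s<k. (\<Sum>i<k. f i * w i) = w s)"
  using assms
proof (induction k)
  case (Suc k)
  show ?case
  proof (cases "f k = 0")
    case True
    then show ?thesis using Suc by (auto intro: less_SucI)
  next
    case False
    then have "f k = 1 \<and> (\<Sum>i<k. f i) = 0" using Suc.prems by (simp del: sum_eq_0_iff)
    then have "f k = 1" "\<forall>i<k. f i = 0" by auto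
    then show ?thesis by auto
  qed
qed simp

lemma wtq_less_max:
  assumes "q \<ge> 1" "u < q ^ k - 1"
  shows "wtq q k u < k * (q - 1)"
proof (rule ccontr)
  assume "\<not> ?thesis"
  then have "(\<Sum>i<k. q - 1 - digit q u i) = 0"
    using digit_complement(2)[OF assms(1), of u k] assms by linarith
  then have "(\<Sum>i<k. (q - 1 - digit q u i) * q ^ i) = 0" by simp
  then show False using digit_complement(1)[OF assms(1), of u k] assms(2) by linarith
qed

text \<open>The complement of \<open>u\<close> has digit sum at most 1 and is nonzero because
  \<open>u < q ^ k - 1\<close>, hence it is a power of \<open>q\<close>.\<close>

lemma wtq_near_max:
  assumes "q \<ge> 1" "u < q ^ k - 1" "k * (q - 1) \<le> wtq q k u + 1"
  shows "\<exists>s<k. u + q ^ s = q ^ k - 1"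
proof -
  have u: "u < q ^ k" using assms by simp
  have "(\<Sum>i<k. q - 1 - digit q u i) \<le> 1"
    using digit_complement(2)[OF assms(1) u] assms(3) by linarith
  from sum_le_1_cases[OF this, of "\<lambda>i. q ^ i"] show ?thesis
    using digit_complement(1)[OF assms(1) u] assms(2) by (metis add.commute add_0 less_irrefl)
qed

lemma wtq_extend:
  assumes "q \<ge> 1" "u < q ^ k" "k \<le> n"
  shows "wtq q n u = wtq q k u"
  unfolding wtq_def
proof (rule sum.mono_neutral_right)
  show "\<forall>i\<in>{..<n} - {..<k}. digit q u i = 0"
  proof
    fix i assume "i \<in> {..<n} - {..<k}"
    then have "q ^ k \<le> q ^ i" using assms by (simp add: power_increasing)
    then show "digit q u i = 0" using assms by (simp add: digit_def)
  qed
qed (use assms in auto)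

lemma wtq_add_power:
  assumes "q \<ge> 2" "t < q ^ k" "k < n"
  shows "wtq q n (q ^ k + t) = 1 + wtq q k t"
proof -
  define f where "f i = (if i < k then digit q t i else if i = k then 1 else 0)" for i
  have f: "f i < q" for i using assms digit_less[of q] by (auto simp: f_def)
  have split: "(\<Sum>i<n. f i * w i) = (\<Sum>i<k. digit q t i * w i) + w k" for w :: "nat \<Rightarrow> nat"
  proof -
    have "(\<Sum>i<n. f i * w i) = (\<Sum>i<Suc k. f i * w i)"
      using assms by (intro sum.mono_neutral_right) (auto simp: f_def)
    then show ?thesis by (simp add: f_def)
  qed
  have "(\<Sum>i<n. f i * q ^ i) = q ^ k + t"
    using split[of "\<lambda>i. q ^ i"] assms by (simp add: sum_digits_mod)
  then show ?thesis
    using wtq_sum_powers[of n f q] f split[of "\<lambda>_. 1"] by (simp add: wtq_def)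
qed

text \<open>Such a \<open>u\<close> has digit 1 at the even position \<open>2 * \<kappa>\<close>;
  below it all digits are \<open>q - 1\<close>, except \<open>q - 2\<close> at the odd position
  \<open>2 * s + 1\<close>. Relative to \<open>\<kappa> * (q - 1)\<close> the even sum gains one and
  the odd sum loses one, which produces the difference 2 missing from \<open>I\<close>.\<close>

lemma Odig_Edig_near_max:
  assumes "q \<ge> 2" "s < \<kappa>" "\<kappa> < m"
    and u: "u + q ^ (2 * s + 1) = q ^ (2 * \<kappa>) + (q ^ (2 * \<kappa>) - 1)"
  shows "Edig q (2 * m) u = \<kappa> * (q - 1) + 1" "Odig q (2 * m) u + 1 = \<kappa> * (q - 1)"
proof -
  define f where "f i = (if i < 2 * \<kappa> then (if i = 2 * s + 1 then q - 2 else q - 1)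
     else if i = 2 * \<kappa> then 1 else 0)" for i
  have f: "f i < q" for i using assms by (auto simp: f_def)
  let ?d = "\<lambda>i. if i = 2 * s + 1 then q ^ i else 0"
  have "(\<Sum>i<2*m. f i * q ^ i) = (\<Sum>i<Suc (2*\<kappa>). f i * q ^ i)"
    using assms by (intro sum.mono_neutral_right) (auto simp: f_def)
  also have "\<dots> = (\<Sum>i<2*\<kappa>. f i * q ^ i) + q ^ (2 * \<kappa>)"
    by (simp add: f_def)
  finally have 1: "(\<Sum>i<2*m. f i * q ^ i) = (\<Sum>i<2*\<kappa>. f i * q ^ i) + q ^ (2 * \<kappa>)" .
  have pt: "f i * q ^ i + ?d i = (q - 1) * q ^ i" if "i < 2 * \<kappa>" for i
  proof -
    have "(q - 2) * q ^ i + q ^ i = (q - 1) * q ^ i"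
      using assms(1) by (metis (no_types) Suc_1 Suc_diff_Suc Suc_le_lessD add.commute mult_Suc
          numeral_2_eq_2 diff_Suc_1 diff_Suc_Suc One_nat_def)
    then show ?thesis using that by (auto simp: f_def)
  qed
  have "(\<Sum>i<2*\<kappa>. f i * q ^ i) + (\<Sum>i<2*\<kappa>. ?d i) = (\<Sum>i<2*\<kappa>. (q - 1) * q ^ i)"
    by (simp only: sum.distrib[symmetric]) (rule sum.cong; use pt in auto)
  moreover have "(\<Sum>i<2*\<kappa>. ?d i) = q ^ (2 * s + 1)"
    using assms by (simp add: sum.delta)
  ultimately have "u = (\<Sum>i<2*m. f i * q ^ i)"
    using 1 u assms(1) sum_powers_complement[of q "2 * \<kappa>"] by linarith
  then have dig: "digit q u i = f i" if "i < 2 * m" for i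
    using digit_sum_powers[of "2*m" f q i] f that by simp
  have "Edig q (2 * m) u = (\<Sum>i<m. f (2 * i))"
    by (simp add: Edig_double dig)
  also have "\<dots> = (\<Sum>i<Suc \<kappa>. f (2 * i))"
    using assms by (intro sum.mono_neutral_right) (auto simp: f_def)
  also have "\<dots> = (\<Sum>i<\<kappa>. q - 1) + 1"
  proof -
    have "f (2 * i) = q - 1" if "i < \<kappa>" for i
    proof -
      have "2 * i \<noteq> 2 * s + 1" by presburger
      then show ?thesis using that by (simp add: f_def)
    qed
    moreover have "f (2 * \<kappa>) = 1" by (simp add: f_def)
    ultimately show ?thesis by simp
  qed
  finally show "Edig q (2 * m) u = \<kappa> * (q - 1) + 1" by simp
  have "Odig q (2 * m) u = (\<Sum>i<m. f (2 * i + 1))"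
    by (simp add: Odig_double dig)
  also have "\<dots> = (\<Sum>i<\<kappa>. f (2 * i + 1))"
  proof (rule sum.mono_neutral_right)
    have "2 * i + 1 \<noteq> 2 * \<kappa>" for i by presburger
    then show "\<forall>i\<in>{..<m} - {..<\<kappa>}. f (2 * i + 1) = 0" by (simp add: f_def)
  qed (use assms in auto)
  also have "\<dots> = (\<Sum>i\<in>{..<\<kappa>} - {s}. q - 1) + (q - 2)"
    using assms by (subst sum.remove[of _ s]) (auto simp: f_def)
  finally have "Odig q (2 * m) u + 1 = (\<kappa> - 1) * (q - 1) + (q - 1)"
    using assms(1,2) by simp
  also have "\<dots> = \<kappa> * (q - 1)" using assms(2) by (cases \<kappa>) auto
  finally show "Odig q (2 * m) u + 1 = \<kappa> * (q - 1)" .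
qed

section \<open>Subspaces over a finite subfield\<close>

text \<open>Span and independence are separated out of \<open>subspace_dim\<close> so that a basis
  can be truncated or extended by one vector.\<close>

definition lspan :: "'a::field set \<Rightarrow> (nat \<Rightarrow> 'a) \<Rightarrow> nat \<Rightarrow> 'a set" where
  "lspan K b d = {(\<Sum>i<d. c i * b i) | c. \<forall>i<d. c i \<in> K}"

definition indep :: "'a::field set \<Rightarrow> (nat \<Rightarrow> 'a) \<Rightarrow> nat \<Rightarrow> bool" where
  "indep K b d \<longleftrightarrow> (\<forall>c. (\<forall>i<d. c i \<in> K) \<and> (\<Sum>i<d. c i * b i) = 0 \<longrightarrow> (\<forall>i<d. c i = 0))"

lemma subspace_dim_iff: "subspace_dim K V d \<longleftrightarrow> (\<exists>b. V = lspan K b d \<and> indep K b d)"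
  by (simp add: subspace_dim_def lspan_def indep_def)

locale finite_subfield =
  fixes K :: "'a::{field,finite} set"
  assumes zero_in: "0 \<in> K" and one_in: "1 \<in> K"
    and add_in: "\<And>x y. x \<in> K \<Longrightarrow> y \<in> K \<Longrightarrow> x + y \<in> K"
    and mult_in: "\<And>x y. x \<in> K \<Longrightarrow> y \<in> K \<Longrightarrow> x * y \<in> K"
    and diff_in: "\<And>x y. x \<in> K \<Longrightarrow> y \<in> K \<Longrightarrow> x - y \<in> K"
    and inverse_in: "\<And>x. x \<in> K \<Longrightarrow> inverse x \<in> K"
begin

lemma indep_antimono:
  assumes "indep K b d" "e \<le> d"
  shows "indep K b e"
  unfolding indep_def
proof (intro allI impI; elim conjE)
  fix c i assume c: "\<forall>i<e. c i \<in> K" "(\<Sum>i<e. c i * b i) = 0" "i < e"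
  define c' where "c' i = (if i < e then c i else 0)" for i
  have "(\<Sum>i<d. c' i * b i) = (\<Sum>i<e. c i * b i)"
    using assms(2) by (intro sum.mono_neutral_cong_right) (auto simp: c'_def)
  moreover have "\<forall>i<d. c' i \<in> K" using c zero_in by (simp add: c'_def)
  ultimately have "c' i = 0" using assms c unfolding indep_def by (metis order_less_le_trans)
  then show "c i = 0" using c by (simp add: c'_def)
qed

text \<open>Coordinates with respect to an independent family are unique. Splitting off the last one
  drives the inductions on dimension, for cardinalities as well as for power sums.\<close>

lemma bij_betw_lspan_Suc:
  assumes "indep K b (Suc d)"
  shows "bij_betw (\<lambda>(v, c). v + c * b d) (lspan K b d \<times> K) (lspan K b (Suc d))"
  unfolding bij_betw_def
proof
  show "inj_on (\<lambda>(v, c). v + c * b d) (lspan K b d \<times> K)"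
  proof (rule inj_onI, clarify)
    fix v c v' c'
    assume "v \<in> lspan K b d" "v' \<in> lspan K b d" and c: "c \<in> K" "c' \<in> K"
      and eq: "v + c * b d = v' + c' * b d"
    then obtain w w' where w: "v = (\<Sum>i<d. w i * b i)" "\<forall>i<d. w i \<in> K"
      "v' = (\<Sum>i<d. w' i * b i)" "\<forall>i<d. w' i \<in> K"
      unfolding lspan_def by auto
    define u where "u i = (if i < d then w i - w' i else c - c')" for i
    have "(\<Sum>i<Suc d. u i * b i) = 0"
      using eq by (simp add: u_def w algebra_simps sum_subtractf)
    moreover have "\<forall>i<Suc d. u i \<in> K" using w c by (auto simp: u_def diff_in)
    ultimately have "\<forall>i<Suc d. u i = 0" using assms unfolding indep_def by blast
    then have "c = c'" by (auto simp: u_def dest: spec[of _ d])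
    then show "v = v' \<and> c = c'" using eq by simp
  qed
  show "(\<lambda>(v, c). v + c * b d) ` (lspan K b d \<times> K) = lspan K b (Suc d)"
  proof safe
    fix v c assume "v \<in> lspan K b d" and c: "c \<in> K"
    then obtain w where w: "v = (\<Sum>i<d. w i * b i)" "\<forall>i<d. w i \<in> K"
      unfolding lspan_def by auto
    have "v + c * b d = (\<Sum>i<Suc d. (w(d := c)) i * b i)" by (simp add: w)
    moreover have "\<forall>i<Suc d. (w(d := c)) i \<in> K" using w c by auto
    ultimately show "v + c * b d \<in> lspan K b (Suc d)" unfolding lspan_def by blast
  next
    fix v assume "v \<in> lspan K b (Suc d)"
    then obtain w where w: "v = (\<Sum>i<Suc d. w i * b i)" "\<forall>i<Suc d. w i \<in> K"
      unfolding lspan_def by auto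
    then have "(\<Sum>i<d. w i * b i) \<in> lspan K b d" unfolding lspan_def by auto
    then show "v \<in> (\<lambda>(v, c). v + c * b d) ` (lspan K b d \<times> K)"
      using w by (intro image_eqI[of _ _ "(\<Sum>i<d. w i * b i, w d)"]) auto
  qed
qed

lemma card_lspan: "indep K b d \<Longrightarrow> card (lspan K b d) = card K ^ d"
proof (induction d)
  case 0
  have "lspan K b 0 = {0}" by (auto simp: lspan_def)
  then show ?case by simp
next
  case (Suc d)
  then show ?case
    using bij_betw_same_card[OF bij_betw_lspan_Suc[OF Suc.prems]] indep_antimono[OF Suc.prems]
    by (simp add: card_cartesian_product mult.commute)
qed

lemma card_ge_2: "2 \<le> card K"
proof -
  have "card {0, 1 :: 'a} \<le> card K"
    by (rule card_mono) (use zero_in one_in in auto)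
  then show ?thesis by simp
qed

text \<open>A longest independent family inside \<open>V\<close> spans it, since a vector outside
  the span would extend the family. Lengths are bounded because an independent family of length
  \<open>d\<close> spans \<open>card K ^ d\<close> elements of a finite field.\<close>

lemma ex_subspace_dim:
  assumes V: "0 \<in> V" "\<And>v w. v \<in> V \<Longrightarrow> w \<in> V \<Longrightarrow> v + w \<in> V"
    "\<And>c v. c \<in> K \<Longrightarrow> v \<in> V \<Longrightarrow> c * v \<in> V"
  shows "\<exists>d. subspace_dim K V d"
proof -
  define P where "P d \<longleftrightarrow> (\<exists>b. indep K b d \<and> (\<forall>i<d. b i \<in> V))" for d
  have bound: "d \<le> card (UNIV :: 'a set)" if Pd: "P d" for d
  proof -
    obtain b where b: "indep K b d" using Pd unfolding P_def by blast
    have "d < 2 ^ d" by (rule less_exp)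
    also have "2 ^ d \<le> card K ^ d" using card_ge_2 by (simp add: power_mono)
    also have "\<dots> = card (lspan K b d)" using b by (simp add: card_lspan)
    also have "\<dots> \<le> card (UNIV :: 'a set)" by (rule card_mono) auto
    finally show ?thesis by simp
  qed
  have "P 0" by (simp add: P_def indep_def)
  define d where "d = (GREATEST d. P d)"
  have "P d" unfolding d_def using \<open>P 0\<close> bound by (rule GreatestI_nat)
  then obtain b where b: "indep K b d" "\<forall>i<d. b i \<in> V" unfolding P_def by blast
  have max: "\<not> P (Suc d)"
    using Greatest_le_nat[of P "Suc d" "card (UNIV :: 'a set)"] bound unfolding d_def by auto
  have sum_in: "(\<Sum>i<e. c i * b i) \<in> V" if "\<forall>i<e. c i \<in> K" "e \<le> d" for c e
    using that
  proof (induction e)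
    case (Suc e)
    then show ?case using b V by simp
  qed (use V in simp)
  have "V \<subseteq> lspan K b d"
  proof (rule ccontr)
    assume "\<not> ?thesis"
    then obtain v where v: "v \<in> V" "v \<notin> lspan K b d" by blast
    have "indep K (b(d := v)) (Suc d)"
      unfolding indep_def
    proof (intro allI impI; elim conjE)
      fix c i assume c: "\<forall>i<Suc d. c i \<in> K"
        and sum: "(\<Sum>i<Suc d. c i * (b(d := v)) i) = 0" and i: "i < Suc d"
      have sum': "(\<Sum>i<d. c i * b i) + c d * v = 0" using sum by simp
      have cd: "c d = 0"
      proof (rule ccontr)
        assume "c d \<noteq> 0"
        \<comment> \<open>Solving the relation for \<open>v\<close> shows that a nonzero
          \<open>c d\<close> would put \<open>v\<close> into the span.\<close>
        define w where "w i = inverse (c d) * (0 - c i)" for i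
        have "v = inverse (c d) * (0 - (\<Sum>i<d. c i * b i))"
          using sum' \<open>c d \<noteq> 0\<close> by (simp add: field_simps eq_neg_iff_add_eq_0)
        also have "\<dots> = (\<Sum>i<d. w i * b i)"
          by (simp add: w_def sum_distrib_left sum_negf algebra_simps)
        finally have "v = (\<Sum>i<d. w i * b i)" .
        moreover have "\<forall>i<d. w i \<in> K"
          unfolding w_def using c by (meson mult_in inverse_in diff_in zero_in less_SucI lessI)
        ultimately show False using v unfolding lspan_def by blast
      qed
      then have "\<forall>i<d. c i = 0" using b(1) c sum' unfolding indep_def by simp
      then show "c i = 0" using cd i by (auto simp: less_Suc_eq)
    qed
    then have "P (Suc d)" unfolding P_def using b v by (auto simp: less_Suc_eq)
    then show False using max by contradiction
  qed
  moreover have "lspan K b d \<subseteq> V" unfolding lspan_def using sum_in by auto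
  ultimately show ?thesis using b(1) unfolding subspace_dim_iff by blast
qed

text \<open>Used for the support of a minimum weight codeword, where closure and cardinality are
  known but no basis is.\<close>

lemma subspace_dim_of_card:
  assumes V: "0 \<in> V" "\<And>v w. v \<in> V \<Longrightarrow> w \<in> V \<Longrightarrow> v + w \<in> V"
    "\<And>c v. c \<in> K \<Longrightarrow> v \<in> V \<Longrightarrow> c * v \<in> V" and card: "card V = card K ^ d"
  shows "subspace_dim K V d"
proof -
  obtain e where e: "subspace_dim K V e" using ex_subspace_dim[OF V] by blast
  then have "card V = card K ^ e" unfolding subspace_dim_iff using card_lspan by auto
  then have "e = d" using card card_ge_2 power_inject_exp[of "card K" e d] by simp
  then show ?thesis using e by simp
qed

end

section \<open>Power sums over subspaces\<close>

text \<open>With \<open>Q = q - 1\<close> one has \<open>q\<^sup>2 - 1 = Q * (Q + 2)\<close>. Since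
  \<open>e + q * f\<close> is congruent to \<open>e + f\<close> modulo \<open>Q\<close>, write
  \<open>e + f = Q * t\<close>; then \<open>Q + 2\<close> divides \<open>t + f\<close>. As
  \<open>f \<le> Q * t\<close>, the case \<open>t = 1\<close> is impossible, \<open>t = 2\<close>
  forces \<open>f = Q\<close>, and \<open>t \<ge> 3\<close> exceeds the bound.\<close>

lemma semilinear_degree_cases:
  fixes e f q :: nat
  assumes "q \<ge> 2" "e + q * f > 0" "(q\<^sup>2 - 1) dvd (e + q * f)"
  shows "e + f > 2 * (q - 1) \<or> (e = q - 1 \<and> f = q - 1)"
proof -
  obtain Q where Q: "q = Suc Q" "Q \<ge> 1" using assms(1) by (cases q) auto
  have q2: "q\<^sup>2 - 1 = Q * (Q + 2)" by (simp add: Q power2_eq_square)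
  have "Q dvd (e + f) + Q * f"
  proof -
    have "Q dvd e + q * f" using assms(3) unfolding q2 by (rule dvd_mult_left)
    then show ?thesis by (simp add: Q algebra_simps)
  qed
  then have "Q dvd e + f" by (simp add: dvd_add_left_iff)
  then obtain t where t: "e + f = Q * t" by blast
  have "e + q * f = Q * (t + f)" using t by (simp add: Q algebra_simps)
  then have dv: "(Q + 2) dvd (t + f)"
    using assms(3) Q(2) nat_mult_dvd_cancel1[of Q "Q + 2" "t + f"] unfolding q2 by simp
  have "t \<noteq> 0" using t assms(2) by (auto intro: gr0I)
  then consider "t = 1" | "t = 2" | "t \<ge> 3" by linarith
  then show ?thesis
  proof cases
    case 1
    then have "t + f < Q + 2" using t by simp
    then show ?thesis using dv 1 nat_dvd_not_less[of "t + f" "Q + 2"] by simp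
  next
    case 2
    obtain s where s: "t + f = (Q + 2) * s" using dv by blast
    have "t + f < (Q + 2) * 2" using t 2 by simp
    then have "s < 2" using s by (metis mult_less_cancel1)
    moreover have "s \<noteq> 0" using s 2 by (intro notI) simp
    ultimately have "s = 1" by simp
    then have "f = Q" using s 2 by simp
    then show ?thesis using t 2 Q by simp
  next
    case 3
    then have "Q * 3 \<le> e + f" using t by simp
    then show ?thesis using Q by simp
  qed
qed

text \<open>
  Expanding the product over \<open>v + c * b d\<close>, a term with \<open>e\<close> linear and \<open>f\<close> semilinear factors
  evaluated at \<open>c * b d\<close> carries \<open>\<Sum>c\<in>K. c ^ (e + q * f)\<close>, so it vanishes unless it consumes
  at least \<open>2 * (q - 1)\<close> factors, with equality only for \<open>e = f\<close>.
\<close>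
lemma (in finite_subfield) sum_prod_semilinear_eq_0:
  assumes q: "q \<ge> 2"
    and pow_sum: "\<And>t. \<not> (t > 0 \<and> (q\<^sup>2 - 1) dvd t) \<Longrightarrow> (\<Sum>c\<in>K. c ^ t) = 0"
    and fin: "finite A" "finite B" and AB: "A \<inter> B = {}"
    and add: "\<And>i v w. i \<in> A \<union> B \<Longrightarrow> h i (v + w) = h i v + h i w"
    and linA: "\<And>i c v. i \<in> A \<Longrightarrow> c \<in> K \<Longrightarrow> h i (c * v) = c * h i v"
    and linB: "\<And>i c v. i \<in> B \<Longrightarrow> c \<in> K \<Longrightarrow> h i (c * v) = c ^ q * h i v"
    and indep: "indep K b d"
    and deg: "card A + card B < 2 * d * (q - 1) \<or>
      card A + card B = 2 * d * (q - 1) \<and> card A \<noteq> card B"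
  shows "(\<Sum>v\<in>lspan K b d. \<Prod>i\<in>A \<union> B. h i v) = 0"
  using fin AB add linA linB indep deg
proof (induction d arbitrary: A B)
  case (Suc d)
  let ?e = "\<lambda>T. card (T \<inter> A) + q * card (T \<inter> B)"
  have prod_c: "(\<Prod>i\<in>T. h i (c * b d)) = c ^ ?e T * (\<Prod>i\<in>T. h i (b d))"
    if T: "T \<subseteq> A \<union> B" and c: "c \<in> K" for T c
  proof -
    have finT: "finite T" using T Suc.prems finite_subset by blast
    have "(\<Prod>i\<in>T. h i (c * b d)) = (\<Prod>i\<in>T. (if i \<in> A then c else c ^ q) * h i (b d))"
      using T c Suc.prems(5,6) by (intro prod.cong) auto
    also have "\<dots> = (\<Prod>i\<in>T. if i \<in> A then c else c ^ q) * (\<Prod>i\<in>T. h i (b d))"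
      by (simp add: prod.distrib)
    also have "(\<Prod>i\<in>T. if i \<in> A then c else c ^ q) = c ^ card (T \<inter> A) * (c ^ q) ^ card (T \<inter> - A)"
      using finT by (simp add: prod.If_cases)
    also have "T \<inter> - A = T \<inter> B" using T Suc.prems(3) by blast
    finally show ?thesis by (simp add: power_add power_mult)
  qed
  have term0: "(\<Sum>c\<in>K. c ^ ?e T) * (\<Sum>v\<in>lspan K b d. \<Prod>i\<in>(A \<union> B) - T. h i v) = 0"
    if T: "T \<subseteq> A \<union> B" for T
  proof (cases "?e T > 0 \<and> (q\<^sup>2 - 1) dvd ?e T")
    case False
    then show ?thesis by (subst pow_sum) simp_all
  next
    case True
    have split: "card (A - T) + card (T \<inter> A) = card A" "card (B - T) + card (T \<inter> B) = card B"
      using Suc.prems(1,2) by (metis Int_commute add.commute card_Diff_subset_Int card_mono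
          finite_Int inf_le1 inf_le2 le_add_diff_inverse2)+
    \<comment> \<open>In the extremal case \<open>T\<close> removes \<open>q - 1\<close> factors of
      each kind, so the imbalance between \<open>A\<close> and \<open>B\<close> survives.\<close>
    have "card (A - T) + card (B - T) < 2 * d * (q - 1) \<or>
      card (A - T) + card (B - T) = 2 * d * (q - 1) \<and> card (A - T) \<noteq> card (B - T)"
    proof -
      have "2 * Suc d * (q - 1) = 2 * d * (q - 1) + 2 * (q - 1)" by simp
      then show ?thesis
        using semilinear_degree_cases[OF q conjunct1[OF True] conjunct2[OF True]] split Suc.prems(8)
        by linarith
    qed
    then have "(\<Sum>v\<in>lspan K b d. \<Prod>i\<in>(A - T) \<union> (B - T). h i v) = 0"
      using Suc.prems(1-6) indep_antimono[OF Suc.prems(7), of d]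
      by (intro Suc.IH) auto
    moreover have "(A - T) \<union> (B - T) = (A \<union> B) - T" by blast
    ultimately show ?thesis by simp
  qed
  have "(\<Sum>v\<in>lspan K b (Suc d). \<Prod>i\<in>A \<union> B. h i v)
      = (\<Sum>(v, c)\<in>lspan K b d \<times> K. \<Prod>i\<in>A \<union> B. h i (v + c * b d))"
    by (subst sum.reindex_bij_betw[OF bij_betw_lspan_Suc[OF Suc.prems(7)], symmetric])
      (simp add: case_prod_beta)
  also have "\<dots> = (\<Sum>v\<in>lspan K b d. \<Sum>c\<in>K. \<Sum>T\<in>Pow (A \<union> B).
      (\<Prod>i\<in>T. h i (c * b d)) * (\<Prod>i\<in>(A \<union> B) - T. h i v))"
  proof -
    have "(\<Prod>i\<in>A \<union> B. h i (v + c * b d)) = (\<Sum>T\<in>Pow (A \<union> B).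
      (\<Prod>i\<in>T. h i (c * b d)) * (\<Prod>i\<in>(A \<union> B) - T. h i v))" for v c
      using Suc.prems(1,2,4) by (subst prod_add[symmetric]) (auto intro!: prod.cong)
    then show ?thesis by (simp only: sum.cartesian_product[symmetric])
  qed
  also have "\<dots> = (\<Sum>T\<in>Pow (A \<union> B). \<Sum>c\<in>K. \<Sum>v\<in>lspan K b d.
      (\<Prod>i\<in>T. h i (c * b d)) * (\<Prod>i\<in>(A \<union> B) - T. h i v))"
    by (subst sum.swap, subst (2) sum.swap, subst sum.swap) simp
  also have "\<dots> = (\<Sum>T\<in>Pow (A \<union> B). (\<Prod>i\<in>T. h i (b d)) *
      ((\<Sum>c\<in>K. c ^ ?e T) * (\<Sum>v\<in>lspan K b d. \<Prod>i\<in>(A \<union> B) - T. h i v)))"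
  proof (rule sum.cong)
    fix T assume "T \<in> Pow (A \<union> B)"
    then have T: "T \<subseteq> A \<union> B" by blast
    have "(\<Sum>c\<in>K. \<Sum>v\<in>lspan K b d. (\<Prod>i\<in>T. h i (c * b d)) * (\<Prod>i\<in>(A \<union> B) - T. h i v))
       = (\<Sum>c\<in>K. (c ^ ?e T * (\<Prod>i\<in>T. h i (b d))) * (\<Sum>v\<in>lspan K b d. \<Prod>i\<in>(A \<union> B) - T. h i v))"
      by (rule sum.cong) (simp_all add: prod_c[OF T] sum_distrib_left)
    also have "\<dots> = (\<Prod>i\<in>T. h i (b d)) *
      ((\<Sum>c\<in>K. c ^ ?e T) * (\<Sum>v\<in>lspan K b d. \<Prod>i\<in>(A \<union> B) - T. h i v))"
      by (simp add: sum_distrib_right sum_distrib_left mult_ac)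
    finally show "(\<Sum>c\<in>K. \<Sum>v\<in>lspan K b d.
        (\<Prod>i\<in>T. h i (c * b d)) * (\<Prod>i\<in>(A \<union> B) - T. h i v)) = \<dots>" .
  qed simp
  also have "\<dots> = 0"
  proof (rule sum.neutral, rule ballI)
    fix T assume "T \<in> Pow (A \<union> B)"
    then show "(\<Prod>i\<in>T. h i (b d)) *
      ((\<Sum>c\<in>K. c ^ ?e T) * (\<Sum>v\<in>lspan K b d. \<Prod>i\<in>(A \<union> B) - T. h i v)) = 0"
      using term0[of T] by (simp only: Pow_iff mult_zero_right)
  qed
  finally show ?case .
qed simp

section \<open>The ambient field: characteristic, Frobenius map and cyclic multiplicative
  group\<close>

locale even_degree_field =
  fixes q m n :: nat and \<alpha> :: "'a::{field,finite}"
  assumes prime_power: "\<exists>p l. prime p \<and> l \<ge> 1 \<and> q = p ^ l"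
    and m: "m \<ge> 1" and n: "n = 2 * m"
    and card_UNIV: "card (UNIV :: 'a set) = q ^ n"
    and primitive: "primitive \<alpha>"
begin

lemma q_ge_2: "q \<ge> 2"
proof -
  obtain p l where p: "prime p" "l \<ge> 1" "q = p ^ l" using prime_power by blast
  have "p ^ 1 \<le> p ^ l" using p prime_ge_1_nat by (intro power_increasing) auto
  then show ?thesis using p prime_ge_2_nat[of p] by simp
qed

text \<open>Translation by 1 permutes the field, so summing all elements shows that its cardinality
  is 0 in it. The characteristic therefore divides a power of \<open>p\<close> and equals
  \<open>p\<close>.\<close>

lemma q_power_char: "prime CHAR('a)" "\<exists>l\<ge>1. q = CHAR('a) ^ l"
proof -
  have pos: "CHAR('a) > 0" by (rule finite_imp_CHAR_pos) simp
  show pr: "prime CHAR('a)" using prime_CHAR_semidom[OF pos] .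
  obtain p l where p: "prime p" "l \<ge> 1" "q = p ^ l" using prime_power by blast
  have "(\<Sum>x\<in>UNIV. x :: 'a) = (\<Sum>x\<in>UNIV. x + 1)"
    by (rule sum.reindex_bij_witness[of _ "\<lambda>x. x + 1" "\<lambda>x. x - 1"]) auto
  then have "of_nat (card (UNIV :: 'a set)) = (0 :: 'a)" by (simp add: sum.distrib)
  then have "CHAR('a) dvd p ^ (l * n)"
    by (simp only: of_nat_eq_0_iff_char_dvd card_UNIV p power_mult)
  then have "CHAR('a) = p" using pr p(1) by (metis prime_dvd_power primes_dvd_imp_eq)
  then show "\<exists>l\<ge>1. q = CHAR('a) ^ l" using p by blast
qed

lemma frobenius_add: "(x + y :: 'a) ^ (q ^ s) = x ^ (q ^ s) + y ^ (q ^ s)"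
proof -
  obtain l where "q = CHAR('a) ^ l" using q_power_char by blast
  then show ?thesis
    using freshmans_dream'[OF q_power_char(1), of "q ^ s" "l * s"] by (simp add: power_mult)
qed

lemma of_nat_q: "of_nat q = (0 :: 'a)"
  using q_power_char by (auto simp: power_0_left of_nat_power)

text \<open>Multiplication by \<open>x\<close> permutes the nonzero elements; the two products are
  compared.\<close>

lemma pow_order: "x \<noteq> 0 \<Longrightarrow> (x :: 'a) ^ (q ^ n - 1) = 1"
proof -
  assume x: "x \<noteq> 0"
  have "(\<Prod>y\<in>UNIV - {0}. y) = (\<Prod>y\<in>UNIV - {0}. x * y)"
    by (rule prod.reindex_bij_witness[of _ "\<lambda>y. x * y" "\<lambda>y. y / x"]) (use x in auto)
  also have "\<dots> = x ^ (q ^ n - 1) * (\<Prod>y\<in>UNIV - {0}. y)"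
    by (simp add: prod.distrib card_UNIV card_Diff_singleton)
  finally show ?thesis by simp
qed

lemma alpha_nonzero: "\<alpha> \<noteq> 0"
  using primitive unfolding primitive_def by blast

lemma alpha_power_mod: "\<alpha> ^ (k mod (q ^ n - 1)) = \<alpha> ^ k"
proof -
  have "\<alpha> ^ k = \<alpha> ^ ((q ^ n - 1) * (k div (q ^ n - 1)) + k mod (q ^ n - 1))" by simp
  also have "\<dots> = \<alpha> ^ (k mod (q ^ n - 1))"
    unfolding power_add power_mult pow_order[OF alpha_nonzero] by simp
  finally show ?thesis ..
qed

lemma nonzero_eq_power:
  assumes "x \<noteq> 0"
  shows "\<exists>k < q ^ n - 1. x = \<alpha> ^ k"
proof -
  obtain k where k: "x = \<alpha> ^ k" using primitive assms unfolding primitive_def by blast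
  have "1 < q ^ n" using q_ge_2 m n by (intro one_less_power) auto
  then have "k mod (q ^ n - 1) < q ^ n - 1" by simp
  then show ?thesis using k alpha_power_mod[of k] by metis
qed

lemma inj_on_powers: "inj_on (\<lambda>k. \<alpha> ^ k) {..<q ^ n - 1}"
proof (rule eq_card_imp_inj_on)
  have "(\<lambda>k. \<alpha> ^ k) ` {..<q ^ n - 1} = UNIV - {0}"
    using nonzero_eq_power primitive unfolding primitive_def by auto
  then show "card ((\<lambda>k. \<alpha> ^ k) ` {..<q ^ n - 1}) = card {..<q ^ n - 1}"
    by (simp add: card_UNIV card_Diff_singleton)
qed simp

lemma power_eq_1_iff: "\<alpha> ^ k = 1 \<longleftrightarrow> (q ^ n - 1) dvd k"
proof
  assume "(q ^ n - 1) dvd k"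
  then show "\<alpha> ^ k = 1" using pow_order[OF alpha_nonzero] by (auto simp: power_mult)
next
  assume 1: "\<alpha> ^ k = 1"
  have pos: "0 < q ^ n - 1" using q_ge_2 m n one_less_power[of q n] by auto
  have "\<alpha> ^ (k mod (q ^ n - 1)) = 1" using 1 alpha_power_mod by simp
  then have "k mod (q ^ n - 1) = 0"
    using inj_onD[OF inj_on_powers, of "k mod (q ^ n - 1)" 0] pos by simp
  then show "(q ^ n - 1) dvd k" by blast
qed

section \<open>The subfield of order \<open>q^2\<close> and power sums over its subspaces\<close>

abbreviation K :: "'a set" where "K \<equiv> subF (q\<^sup>2)"

lemma order_factor: "\<exists>M. M > 0 \<and> q ^ n - 1 = (q\<^sup>2 - 1) * M"
proof -
  define M where "M = (\<Sum>i<m. (q\<^sup>2) ^ i)"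
  have "q ^ n = (q\<^sup>2) ^ m" by (simp add: n power_mult)
  moreover have "q\<^sup>2 \<ge> 1" using q_ge_2 by simp
  ultimately have "q ^ n - 1 = (q\<^sup>2 - 1) * M"
    using sum_powers_complement[of "q\<^sup>2" m] by (simp add: M_def sum_distrib_left)
  moreover have "0 < q ^ n - 1" using q_ge_2 m n one_less_power[of q n] by auto
  ultimately show ?thesis by (metis gr0I mult_0_right)
qed

lemma q2_gt_1: "q\<^sup>2 > 1"
  using q_ge_2 by (intro one_less_power) auto

sublocale K: finite_subfield K
proof
  show zero: "0 \<in> K" and "1 \<in> K" using q_ge_2 by (auto simp: subF_def)
  fix x y :: 'a assume xy: "x \<in> K" "y \<in> K"
  then show "x + y \<in> K" "x * y \<in> K"
    using frobenius_add[of x y 2] by (auto simp: subF_def power_mult_distrib)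
  show "x - y \<in> K"
    using frobenius_add[of "x - y" y 2] xy by (simp add: subF_def eq_diff_eq)
qed (simp add: subF_def power_inverse)

text \<open>A nonzero \<open>y\<close> in \<open>K\<close> satisfies
  \<open>y ^ (q\<^sup>2 - 1) = 1\<close>; for \<open>y = \<alpha> ^ j\<close> this says that
  \<open>M\<close> divides \<open>j\<close>.\<close>

lemma K_nonzero:
  assumes M: "q ^ n - 1 = (q\<^sup>2 - 1) * M" "M > 0"
  shows "K - {0} = (\<lambda>i. \<alpha> ^ (M * i)) ` {..<q\<^sup>2 - 1}"
proof (intro equalityI subsetI)
  fix y assume y: "y \<in> K - {0}"
  then obtain j where j: "j < q ^ n - 1" "y = \<alpha> ^ j" using nonzero_eq_power by blast
  have "y * y ^ (q\<^sup>2 - 1) = y ^ q\<^sup>2" using q_ge_2 by (intro power_minus_mult[of _ y, unfolded mult.commute[of _ y]]) simp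
  then have "y ^ (q\<^sup>2 - 1) = 1" using y by (simp add: subF_def)
  then have "(q\<^sup>2 - 1) * M dvd j * (q\<^sup>2 - 1)"
    using M j power_eq_1_iff[of "j * (q\<^sup>2 - 1)"] by (simp add: power_mult)
  then have "M dvd j" using q2_gt_1 by (simp add: mult.commute[of j])
  then obtain i where i: "j = M * i" by blast
  then have "M * i < M * (q\<^sup>2 - 1)" using j M by (simp add: mult.commute)
  then show "y \<in> (\<lambda>i. \<alpha> ^ (M * i)) ` {..<q\<^sup>2 - 1}" using i j by auto
next
  fix y assume "y \<in> (\<lambda>i. \<alpha> ^ (M * i)) ` {..<q\<^sup>2 - 1}"
  then obtain i where y: "y = \<alpha> ^ (M * i)" by blast
  have "y ^ (q\<^sup>2 - 1) = \<alpha> ^ ((q ^ n - 1) * i)" by (simp only: y M(1) power_mult[symmetric] mult_ac)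
  also have "\<dots> = 1" using power_eq_1_iff by simp
  finally have "y * y ^ (q\<^sup>2 - 1) = y" by simp
  moreover have "y * y ^ (q\<^sup>2 - 1) = y ^ q\<^sup>2" using q_ge_2 by (intro power_minus_mult[of _ y, unfolded mult.commute[of _ y]]) simp
  ultimately show "y \<in> K - {0}" using y alpha_nonzero by (simp add: subF_def)
qed

lemma card_K: "card K = q\<^sup>2"
proof -
  obtain M where M: "M > 0" "q ^ n - 1 = (q\<^sup>2 - 1) * M" using order_factor by blast
  have "inj_on (\<lambda>i. \<alpha> ^ (M * i)) {..<q\<^sup>2 - 1}"
  proof (rule inj_onI)
    fix i j assume ij: "i \<in> {..<q\<^sup>2 - 1}" "j \<in> {..<q\<^sup>2 - 1}" "\<alpha> ^ (M * i) = \<alpha> ^ (M * j)"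
    then have "M * i < q ^ n - 1" "M * j < q ^ n - 1"
      unfolding M(2) using M(1) by (simp_all add: mult.commute)
    then have "M * i = M * j" using inj_onD[OF inj_on_powers ij(3)] by simp
    then show "i = j" using M(1) by simp
  qed
  then have "card (K - {0}) = q\<^sup>2 - 1"
    unfolding K_nonzero[OF M(2,1)] by (simp add: card_image)
  then show ?thesis using K.zero_in q2_gt_1 by (simp add: card_Diff_singleton)
qed

text \<open>For \<open>t = 0\<close> every term is 1, also \<open>0 ^ 0\<close>, and the sum
  \<open>q\<^sup>2\<close> is 0 in this characteristic. Otherwise scaling the summation variable by
  the generator \<open>\<beta>\<close> multiplies the sum by \<open>\<beta> ^ t\<close>, which is
  not 1.\<close>

lemma sum_K_power:
  assumes "\<not> (t > 0 \<and> (q\<^sup>2 - 1) dvd t)"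
  shows "(\<Sum>c\<in>K. c ^ t) = 0"
proof (cases "t = 0")
  case True
  then show ?thesis by (simp add: card_K of_nat_q)
next
  case False
  then have nd: "\<not> (q\<^sup>2 - 1) dvd t" using assms by simp
  obtain M where M: "M > 0" "q ^ n - 1 = (q\<^sup>2 - 1) * M" using order_factor by blast
  define \<beta> where "\<beta> = \<alpha> ^ M"
  have "\<beta> ^ (q\<^sup>2 - 1) = 1"
    using pow_order[OF alpha_nonzero] by (simp only: \<beta>_def M mult.commute[of _ M] power_mult)
  moreover have "\<beta> * \<beta> ^ (q\<^sup>2 - 1) = \<beta> ^ q\<^sup>2" using q_ge_2 by (intro power_minus_mult[of _ \<beta>, unfolded mult.commute[of _ \<beta>]]) simp
  ultimately have \<beta>: "\<beta> \<in> K" "\<beta> \<noteq> 0" using alpha_nonzero by (simp_all add: subF_def \<beta>_def)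
  have "\<beta> ^ t \<noteq> 1"
    using power_eq_1_iff[of "M * t"] nd M by (simp add: \<beta>_def mult.commute[of "q\<^sup>2 - 1"] flip: power_mult)
  moreover have "(\<Sum>c\<in>K. c ^ t) = (\<Sum>c\<in>K. (\<beta> * c) ^ t)"
    by (rule sum.reindex_bij_witness[of _ "\<lambda>c. \<beta> * c" "\<lambda>c. inverse \<beta> * c"])
      (use \<beta> K.mult_in K.inverse_in in \<open>auto simp flip: mult.assoc\<close>)
  moreover have "(\<Sum>c\<in>K. (\<beta> * c) ^ t) = \<beta> ^ t * (\<Sum>c\<in>K. c ^ t)"
    by (simp add: power_mult_distrib sum_distrib_left)
  ultimately show ?thesis by (metis mult_cancel_right1)
qed

lemma K_power_even: "c \<in> K \<Longrightarrow> c ^ (q ^ (2 * i)) = c"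
proof (induction i)
  case (Suc i)
  have "c ^ (q ^ (2 * Suc i)) = (c ^ (q ^ (2 * i))) ^ q\<^sup>2"
    by (simp add: power_mult[symmetric] power_add[symmetric] mult.commute)
  then show ?case using Suc by (simp add: subF_def)
qed simp

text \<open>On \<open>K\<close> the Frobenius powers depend only on parity, so
  \<open>v ^ (q ^ i)\<close> is \<open>K\<close>-linear in \<open>v\<close> for even
  \<open>i\<close> and semilinear for odd \<open>i\<close>.\<close>

lemma K_power: "c \<in> K \<Longrightarrow> c ^ (q ^ i) = (if even i then c else c ^ q)"
  using K_power_even[of c "i div 2"]
  by (cases "even i") (auto elim!: evenE oddE simp: power_mult mult.commute[of q])

lemma sum_power_subspace:
  assumes V: "subspace_dim K V d" and u: "u < q ^ n"
    and deg: "wtq q n u < 2 * d * (q - 1) \<or>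
      wtq q n u = 2 * d * (q - 1) \<and> Odig q n u \<noteq> Edig q n u"
  shows "(\<Sum>v\<in>V. v ^ u) = 0"
proof -
  obtain b where b: "V = lspan K b d" "indep K b d" using V subspace_dim_iff by blast
  \<comment> \<open>A digit \<open>c\<close> at position \<open>i\<close> contributes
    \<open>c\<close> factors \<open>v ^ (q ^ i)\<close>. The pairs in \<open>A\<close> index the
    linear factors, those in \<open>B\<close> the semilinear ones.\<close>
  define A where "A = (SIGMA i:{i. i < n \<and> even i}. {..<digit q u i})"
  define B where "B = (SIGMA i:{i. i < n \<and> odd i}. {..<digit q u i})"
  have card: "card A = Edig q n u" "card B = Odig q n u"
    by (simp_all add: A_def B_def Edig_def Odig_def)
  have AB: "A \<union> B = (SIGMA i:{..<n}. {..<digit q u i})" by (auto simp: A_def B_def)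
  have "v ^ u = (\<Prod>x\<in>A \<union> B. v ^ (q ^ fst x))" for v :: 'a
  proof -
    have "v ^ u = (\<Prod>i<n. v ^ (digit q u i * q ^ i))"
      using u sum_digits_mod[where k = n and q = q and u = u] by (simp flip: power_sum)
    also have "\<dots> = (\<Prod>i<n. \<Prod>j<digit q u i. v ^ (q ^ i))"
      by (simp add: power_mult[symmetric] mult.commute)
    also have "\<dots> = (\<Prod>x\<in>A \<union> B. v ^ (q ^ fst x))"
      unfolding AB by (subst prod.Sigma) (simp_all add: case_prod_beta)
    finally show ?thesis .
  qed
  moreover have "(\<Sum>v\<in>lspan K b d. \<Prod>x\<in>A \<union> B. v ^ (q ^ fst x)) = 0"
  proof (rule K.sum_prod_semilinear_eq_0[OF q_ge_2 sum_K_power _ _ _ _ _ _ b(2)])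
    show "card A + card B < 2 * d * (q - 1) \<or>
      card A + card B = 2 * d * (q - 1) \<and> card A \<noteq> card B"
      using deg by (auto simp: card wtq_eq_Odig_plus_Edig add.commute)
  qed (auto simp: A_def B_def frobenius_add power_mult_distrib K_power)
  ultimately show ?thesis by (simp only: b(1))
qed

lemma ex_subspace: "d \<le> m \<Longrightarrow> \<exists>V. subspace_dim K V d"
proof -
  assume d: "d \<le> m"
  have "card (UNIV :: 'a set) = card K ^ m" by (simp add: card_UNIV card_K n power_mult)
  then have "subspace_dim K UNIV m" by (intro K.subspace_dim_of_card) auto
  then obtain b where "indep K b m" using subspace_dim_iff by blast
  then show ?thesis using K.indep_antimono[OF _ d] subspace_dim_iff by blast
qed

lemma card_subspace: "subspace_dim K V d \<Longrightarrow> card V = q ^ (2 * d)"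
  using K.card_lspan by (auto simp: subspace_dim_iff card_K power_mult)

lemma zero_in_subspace: "subspace_dim K V d \<Longrightarrow> 0 \<in> V"
  using K.zero_in by (auto simp: subspace_dim_iff lspan_def intro!: exI[of _ "\<lambda>_. 0"])

end

section \<open>Minimum weight codewords\<close>

text \<open>The syndrome of \<open>x\<close> at exponent \<open>u\<close>.\<close>

definition moment :: "('a::{field,finite} \<Rightarrow> 'a) \<Rightarrow> nat \<Rightarrow> 'a" where
  "moment x u = (\<Sum>g\<in>{g. g \<noteq> 0}. x g * g ^ u)"

lemma sum_poly_eq_moments:
  "(\<Sum>g\<in>{g. g \<noteq> 0}. x g * g ^ i * poly f g) = (\<Sum>j\<le>degree f. coeff f j * moment x (i + j))"
proof -
  have "(\<Sum>g\<in>{g. g \<noteq> 0}. x g * g ^ i * poly f g)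
      = (\<Sum>g\<in>{g. g \<noteq> 0}. \<Sum>j\<le>degree f. coeff f j * (x g * g ^ (i + j)))"
    by (simp add: poly_altdef sum_distrib_left power_add mult_ac)
  also have "\<dots> = (\<Sum>j\<le>degree f. coeff f j * moment x (i + j))"
    by (subst sum.swap) (simp add: moment_def sum_distrib_left)
  finally show ?thesis .
qed

text \<open>The locator polynomial of coding theory in monic form, with its roots at the support
  itself rather than at the inverses.\<close>

definition locator :: "'a::{field,finite} set \<Rightarrow> 'a poly" where
  "locator S = (\<Prod>g\<in>S. [:- g, 1:])"

lemma locator_simps:
  "degree (locator S) = card S" "coeff (locator S) (card S) = 1"
  "poly (locator S) y = 0 \<longleftrightarrow> y \<in> S"
proof -
  show deg: "degree (locator S) = card S"
    unfolding locator_def by (subst degree_prod_sum_eq) auto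
  have "lead_coeff (locator S) = 1" unfolding locator_def by (simp add: lead_coeff_prod)
  then show "coeff (locator S) (card S) = 1" by (simp add: deg)
  show "poly (locator S) y = 0 \<longleftrightarrow> y \<in> S"
    unfolding locator_def by (auto simp: poly_prod prod_zero_iff)
qed

text \<open>This is the BCH bound in contrapositive form: a polynomial vanishing on the support
  except at \<open>g0\<close> isolates \<open>x g0\<close> as a combination of moments.\<close>

lemma ex_moment_nonzero:
  assumes "x 0 = 0" "x \<noteq> (\<lambda>_. 0)"
  shows "\<exists>u. 1 \<le> u \<and> u \<le> hwt x \<and> moment x u \<noteq> 0"
proof (rule ccontr)
  assume contra: "\<not> ?thesis"
  define S where "S = {g. g \<noteq> 0 \<and> x g \<noteq> 0}"
  obtain g0 where g0: "g0 \<in> S" 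
  proof -
    obtain g where "x g \<noteq> 0" using assms(2) by blast
    then show ?thesis using that[of g] assms(1) unfolding S_def by blast
  qed
  define f where "f = locator (S - {g0})"
  have deg: "Suc (degree f) = hwt x"
  proof -
    have "hwt x = card S" by (simp add: hwt_def S_def)
    then show ?thesis using card_Suc_Diff1[of S g0] g0 by (simp add: f_def locator_simps)
  qed
  \<comment> \<open>As \<open>f\<close> has degree \<open>hwt x - 1\<close>, the extra factor
    \<open>g ^ 1\<close> makes exactly the exponents from 1 to \<open>hwt x\<close> occur and avoids
    exponent 0.\<close>
  have "(\<Sum>g\<in>{g. g \<noteq> 0}. x g * g ^ 1 * poly f g) = (\<Sum>j\<le>degree f. coeff f j * moment x (1 + j))"
    by (rule sum_poly_eq_moments)
  also have "\<dots> = 0"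
    using contra deg by (intro sum.neutral) auto
  finally have "(\<Sum>g\<in>{g. g \<noteq> 0}. x g * g ^ 1 * poly f g) = 0" .
  also have "(\<Sum>g\<in>{g. g \<noteq> 0}. x g * g ^ 1 * poly f g) = (\<Sum>g\<in>{g0}. x g * g ^ 1 * poly f g)"
    using g0 by (intro sum.mono_neutral_right) (auto simp: S_def f_def locator_simps)
  finally show False using g0 by (simp add: S_def f_def locator_simps)
qed

section \<open>The code: vanishing moments, weight bound and minimum weight codewords\<close>

locale even_degree_code = even_degree_field q m n \<alpha> for q m n :: nat and \<alpha> :: "'a::{field,finite}" +
  fixes r \<kappa> :: nat and I :: "nat set"
  assumes r: "r = 2 * (m - \<kappa>) * (q - 1)" and \<kappa>: "1 \<le> \<kappa>" "\<kappa> \<le> m"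
    and I: "0 \<in> I" "2 \<notin> I"
begin

abbreviation C :: "('a \<Rightarrow> 'a) set" where "C \<equiv> code q n \<alpha> r I"

text \<open>The weight cutoff \<open>n * (q - 1) - r\<close> in both \<open>Zset\<close> and
  \<open>Theta\<close> becomes \<open>2 * \<kappa> * (q - 1)\<close>, the critical degree for power
  sums over subspaces of dimension \<open>\<kappa>\<close>.\<close>

lemma top_degree: "n * (q - 1) = 2 * \<kappa> * (q - 1) + r"
proof -
  have "n = 2 * \<kappa> + 2 * (m - \<kappa>)" using n \<kappa> by simp
  then show ?thesis unfolding r by (metis add_mult_distrib)
qed

lemma code_0: "x \<in> C \<Longrightarrow> x 0 = 0"
  by (simp add: code_def)

lemma moment_low:
  assumes "x \<in> C" "0 < u" "u \<le> q ^ n - 1" "wtq q n u < 2 * \<kappa> * (q - 1)"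
  shows "moment x u = 0"
proof -
  have "wtq q n u + r + 1 \<le> n * (q - 1)" using assms(4) top_degree by linarith
  then have "\<alpha> ^ u \<in> ZrI q n \<alpha> r I" using assms unfolding ZrI_def Zset_def by blast
  then show ?thesis using assms unfolding code_def moment_def by auto
qed

lemma moment_unbalanced:
  assumes "x \<in> C" "0 < u" "u \<le> q ^ n - 1" "2 \<le> m * (q - 1)"
    "Edig q n u = \<kappa> * (q - 1) + 1" "Odig q n u + 1 = \<kappa> * (q - 1)"
  shows "moment x u = 0"
proof -
  have "int (wtq q n u) = int (n * (q - 1)) - int r"
    using assms(5,6) top_degree unfolding wtq_eq_Odig_plus_Edig by linarith
  moreover have "\<bar>int (Odig q n u) - int (Edig q n u)\<bar> = int 2" using assms(5,6) by linarith
  ultimately have "\<alpha> ^ u \<in> Theta q n \<alpha> r 2" using assms(3) unfolding Theta_def by blast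
  moreover have "2 \<in> Mset q (n div 2) r - I" using assms(4) I by (simp add: Mset_def n r)
  ultimately have "\<alpha> ^ u \<in> ZrI q n \<alpha> r I" unfolding ZrI_def by blast
  then show ?thesis using assms unfolding code_def moment_def by auto
qed

lemma q_power_mono: "q ^ (2 * \<kappa>) \<le> q ^ n"
  using q_ge_2 \<kappa> n by (intro power_increasing) auto

lemma moment_initial:
  assumes "x \<in> C" "0 < u" "u < q ^ (2 * \<kappa>) - 1"
  shows "moment x u = 0"
proof (rule moment_low[OF assms(1,2)])
  show "u \<le> q ^ n - 1" using assms q_power_mono by linarith
  have "wtq q n u = wtq q (2 * \<kappa>) u"
    using assms q_ge_2 n \<kappa> by (intro wtq_extend) auto
  also have "\<dots> < 2 * \<kappa> * (q - 1)" using assms q_ge_2 by (intro wtq_less_max) auto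
  finally show "wtq q n u < 2 * \<kappa> * (q - 1)" .
qed

lemma min_weight_bound:
  assumes "x \<in> C" "x \<noteq> (\<lambda>_. 0)"
  shows "q ^ (2 * \<kappa>) - 1 \<le> hwt x"
proof (rule ccontr)
  assume "\<not> ?thesis"
  then show False
    using ex_moment_nonzero[OF code_0[OF assms(1)] assms(2)] moment_initial[OF assms(1)] by force
qed

lemma subspace_indicator_in_code:
  assumes V: "subspace_dim K V \<kappa>" and lam: "lam \<in> subF q"
  shows "(\<lambda>g. if g \<in> V - {0} then lam else 0) \<in> C"
proof -
  let ?x = "\<lambda>g. if g \<in> V - {0} then lam else 0"
  have "(\<Sum>g\<in>{g. g \<noteq> 0}. ?x g * g ^ u) = 0" if u: "u \<in> {1..q ^ n - 1}" "\<alpha> ^ u \<in> ZrI q n \<alpha> r I" for u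
  proof -
    \<comment> \<open>Membership of \<open>\<alpha> ^ u\<close> only yields some exponent
      \<open>w\<close> with the same power of \<open>\<alpha>\<close>; since
      \<open>g ^ u = g ^ w\<close> for nonzero \<open>g\<close>, it can replace
      \<open>u\<close>.\<close>
    obtain w where w: "\<alpha> ^ u = \<alpha> ^ w" "w \<le> q ^ n - 1" "w > 0"
      "wtq q n w < 2 * \<kappa> * (q - 1) \<or> wtq q n w = 2 * \<kappa> * (q - 1) \<and> Odig q n w \<noteq> Edig q n w"
    proof (cases "\<alpha> ^ u \<in> Zset q n \<alpha> r")
      case True
      then obtain w where "\<alpha> ^ u = \<alpha> ^ w" "w \<le> q ^ n - 1" "w > 0" "wtq q n w + r + 1 \<le> n * (q - 1)"
        unfolding Zset_def by blast
      then show ?thesis using that top_degree by simp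
    next
      case False
      then obtain k where "k \<notin> I" "\<alpha> ^ u \<in> Theta q n \<alpha> r k" using u unfolding ZrI_def by blast
      then obtain w where w: "\<alpha> ^ u = \<alpha> ^ w" "w \<le> q ^ n - 1"
        "int (wtq q n w) = int (n * (q - 1)) - int r" "\<bar>int (Odig q n w) - int (Edig q n w)\<bar> = int k"
        unfolding Theta_def by blast
      \<comment> \<open>Here \<open>0 \<in> I\<close> enters: the odd and even digit sums of
        \<open>w\<close> must differ.\<close>
      have k: "k \<noteq> 0" using \<open>k \<notin> I\<close> I by metis
      have wt: "wtq q n w = 2 * \<kappa> * (q - 1)" using w(3) top_degree by linarith
      have "w \<noteq> 0"
      proof
        assume "w = 0"
        then have "wtq q n w = 0" by (simp add: wtq_def digit_def)
        then show False using wt \<kappa> q_ge_2 by simp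
      qed
      then show ?thesis using that w wt k by auto
    qed
    have same: "g ^ u = g ^ w" if g: "g \<noteq> 0" for g :: 'a
    proof -
      obtain j where "g = \<alpha> ^ j" using nonzero_eq_power[OF g] by blast
      then show ?thesis using w(1) by (metis power_mult mult.commute)
    qed
    have "(\<Sum>g\<in>{g. g \<noteq> 0}. ?x g * g ^ u) = (\<Sum>g\<in>V - {0}. lam * g ^ w)"
      by (rule sum.mono_neutral_cong_right) (auto simp: same)
    \<comment> \<open>The added term at 0 vanishes because \<open>w > 0\<close>.\<close>
    also have "\<dots> = (\<Sum>g\<in>V. lam * g ^ w)"
      using w(3) by (intro sum.mono_neutral_left) auto
    also have "\<dots> = 0"
    proof -
      have "w < q ^ n" using w(2) q_ge_2 by (simp add: le_less_trans)
      then show ?thesis using sum_power_subspace[OF V _ w(4)] by (simp flip: sum_distrib_left)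
    qed
    finally show ?thesis .
  qed
  moreover have "?x g \<in> subF q" for g using lam q_ge_2 by (simp add: subF_def)
  ultimately show ?thesis unfolding code_def by auto
qed

lemma hwt_subspace_indicator:
  assumes V: "subspace_dim K V \<kappa>" and lam: "lam \<noteq> 0"
  shows "hwt (\<lambda>g. if g \<in> V - {0} then lam else 0) = q ^ (2 * \<kappa>) - 1"
proof -
  have "{g. g \<noteq> 0 \<and> (if g \<in> V - {0} then lam else 0) \<noteq> 0} = V - {0}" using lam by auto
  then show ?thesis
    using card_subspace[OF V] zero_in_subspace[OF V] by (simp add: hwt_def card_Diff_singleton)
qed

lemma code_diff_scale:
  assumes "x \<in> C" "y \<in> C" "c \<in> subF q"
  shows "(\<lambda>g. x g - c * y g) \<in> C"
proof -
  have sub: "a - c * b \<in> subF q" if "a \<in> subF q" "b \<in> subF q" for a b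
    using that assms(3) frobenius_add[of "a - c * b" "c * b" 1]
    by (simp add: subF_def power_mult_distrib eq_diff_eq)
  have "(\<Sum>g\<in>{g. g \<noteq> 0}. (x g - c * y g) * g ^ u)
    = (\<Sum>g\<in>{g. g \<noteq> 0}. x g * g ^ u) - c * (\<Sum>g\<in>{g. g \<noteq> 0}. y g * g ^ u)" for u
    by (simp add: algebra_simps sum_subtractf sum_distrib_left)
  then show ?thesis using assms(1,2) sub unfolding code_def by auto
qed

text \<open>
  For \<open>k = 2 * \<kappa>\<close>, \<open>d = q ^ k - 1\<close> and \<open>i = d - j0\<close>, the Newton identity
  \<open>(\<Sum>j\<le>d. coeff P j * moment x (i + j)) = 0\<close> has the term \<open>coeff P j0 * moment x d\<close>,
  terms \<open>j < j0\<close> with exponent below \<open>d\<close>, and terms \<open>j > j0\<close> with exponent \<open>q ^ k + t\<close>, whose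
  moment can only survive if \<open>t = d - q ^ s\<close>; by downward induction on \<open>j0\<close> these have
  \<open>coeff P j = 0\<close> except for \<open>j = d\<close>, where \<open>s\<close> is odd and the condition at \<open>2 \<notin> I\<close> applies.
\<close>
lemma coeff_locator_eq_0:
  assumes x: "x \<in> C" "x \<noteq> (\<lambda>_. 0)" "hwt x = q ^ (2 * \<kappa>) - 1" and \<kappa>m: "\<kappa> < m"
    and S: "S = {g. g \<noteq> 0 \<and> x g \<noteq> 0}"
    and j0: "j0 < q ^ (2 * \<kappa>) - 1" "\<nexists>s. even s \<and> j0 + 1 = q ^ s"
  shows "coeff (locator S) j0 = 0"
proof -
  define k where "k = 2 * \<kappa>"
  define d where "d = q ^ k - 1"
  let ?P = "locator S"
  have qk: "q ^ k = Suc d" using q_ge_2 by (simp add: d_def)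
  have kn: "k < n" "0 < k" using \<kappa>m n \<kappa> by (simp_all add: k_def)
  have card: "card S = d" using x(3) by (simp add: S hwt_def d_def k_def)
  \<comment> \<open>Since \<open>\<kappa> < m\<close>, there is room above \<open>q ^ k\<close> for
    the exponents \<open>q ^ k + t\<close> among the parity checks.\<close>
  have range: "q ^ k + t \<le> q ^ n - 1" if "t < d" for t
  proof -
    have "2 * q ^ k \<le> q ^ Suc k" using q_ge_2 by simp
    also have "\<dots> \<le> q ^ n" using q_ge_2 kn by (intro power_increasing) auto
    finally show ?thesis using that qk by linarith
  qed
  \<comment> \<open>The BCH argument gives a nonzero moment at some exponent from 1 to
    \<open>d\<close>, and those below \<open>d\<close> vanish.\<close>
  have md: "moment x d \<noteq> 0"
  proof -
    obtain u where u: "1 \<le> u" "u \<le> d" "moment x u \<noteq> 0"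
      using ex_moment_nonzero[OF code_0[OF x(1)] x(2)] x(3) by (auto simp: d_def k_def)
    have "\<not> u < d"
    proof
      assume "u < d"
      then show False using moment_initial[OF x(1), of u] u by (simp add: d_def k_def)
    qed
    then have "u = d" using u(2) by simp
    then show ?thesis using u(3) by blast
  qed
  have newton: "(\<Sum>j\<le>d. coeff ?P j * moment x (i + j)) = 0" for i
  proof -
    have "(\<Sum>g\<in>{g. g \<noteq> 0}. x g * g ^ i * poly ?P g) = 0"
      by (rule sum.neutral) (auto simp: locator_simps S)
    then show ?thesis by (simp add: sum_poly_eq_moments locator_simps card)
  qed
  have "j0 < d \<Longrightarrow> \<nexists>s. even s \<and> j0 + 1 = q ^ s \<Longrightarrow> coeff ?P j0 = 0" for j0
  proof (induction "d - j0" arbitrary: j0 rule: less_induct)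
    case less
    have zero: "coeff ?P j * moment x (d - j0 + j) = 0" if j: "j \<le> d" "j \<noteq> j0" for j
    proof (cases "j < j0")
      case True
      then have "moment x (d - j0 + j) = 0"
        using less.prems by (intro moment_initial[OF x(1)]) (auto simp: d_def k_def)
      then show ?thesis by simp
    next
      case False
      define t where "t = j - j0 - 1"
      have t: "j = t + j0 + 1" "t < d" "d - j0 + j = q ^ k + t"
        using False j less.prems qk by (auto simp: t_def)
      have wt: "wtq q n (q ^ k + t) = 1 + wtq q k t"
        using q_ge_2 kn t qk by (intro wtq_add_power) auto
      show ?thesis
      proof (cases "1 + wtq q k t < k * (q - 1)")
        case True
        then have "moment x (q ^ k + t) = 0"
          using range[OF t(2)] wt qk by (intro moment_low[OF x(1)]) (auto simp: k_def)
        then show ?thesis by (simp only: t(3) mult_zero_right)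
      next
        case False
        then obtain s where s: "s < k" "t + q ^ s = d"
          using wtq_near_max[of q t k] t(2) q_ge_2 by (auto simp: d_def)
        show ?thesis
        proof (cases "j0 + 1 = q ^ s")
          case True
          then have "odd s" using less.prems by blast
          then obtain s' where s': "s = 2 * s' + 1" by (blast elim: oddE)
          have bal: "Edig q (2 * m) (q ^ k + t) = \<kappa> * (q - 1) + 1"
            "Odig q (2 * m) (q ^ k + t) + 1 = \<kappa> * (q - 1)"
          proof -
            have "s' < \<kappa>" using s s' by (simp add: k_def)
            moreover have "q ^ k + t + q ^ (2 * s' + 1) = q ^ (2 * \<kappa>) + (q ^ (2 * \<kappa>) - 1)"
              using s(2) unfolding s' d_def k_def by linarith
            ultimately show "Edig q (2 * m) (q ^ k + t) = \<kappa> * (q - 1) + 1"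
              "Odig q (2 * m) (q ^ k + t) + 1 = \<kappa> * (q - 1)"
              using Odig_Edig_near_max[OF q_ge_2 _ \<kappa>m] by blast+
          qed
          \<comment> \<open>From \<open>1 \<le> \<kappa> < m\<close> follows
            \<open>m \<ge> 2\<close>, so 2 is in the range of \<open>Mset\<close>.\<close>
          have "2 * 1 \<le> m * (q - 1)" using q_ge_2 \<kappa> \<kappa>m by (intro mult_mono) auto
          then have "moment x (q ^ k + t) = 0"
            using range[OF t(2)] bal qk by (intro moment_unbalanced[OF x(1)]) (auto simp: n)
          then show ?thesis by (simp only: t(3) mult_zero_right)
        next
          case False
          then have lt: "j0 + 1 < q ^ s" using t s j by simp
          have jd: "j < d" using t s lt by simp
          \<comment> \<open>As \<open>j + 1 = q ^ k - q ^ s + j0 + 1\<close> with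
            \<open>s < k\<close>, it lies strictly between \<open>q ^ (k - 1)\<close> and
            \<open>q ^ k\<close>. Hence it is no power of \<open>q\<close> and the induction
            hypothesis applies to \<open>j\<close>.\<close>
          have "q ^ (k - 1) < j + 1"
          proof -
            have "2 * q ^ (k - 1) \<le> q * q ^ (k - 1)" using q_ge_2 by simp
            moreover have "q * q ^ (k - 1) = q ^ k" using kn by (simp flip: power_Suc)
            moreover have "q ^ s \<le> q ^ (k - 1)" using s q_ge_2 by (intro power_increasing) auto
            ultimately show ?thesis using t s qk by linarith
          qed
          moreover have "j + 1 < q ^ k" using jd qk by simp
          ultimately have "j + 1 \<noteq> q ^ e" for e
            using power_less_imp_less_exp[of q "k - 1" e] power_less_imp_less_exp[of q e k] q_ge_2
            by fastforce
          moreover have "d - j < d - j0" using jd t by simp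
          ultimately have "coeff ?P j = 0" using jd by (intro less.hyps) auto
          then show ?thesis by simp
        qed
      qed
    qed
    have "0 = (\<Sum>j\<le>d. coeff ?P j * moment x (d - j0 + j))" by (simp add: newton)
    also have "\<dots> = (\<Sum>j\<in>{j0}. coeff ?P j * moment x (d - j0 + j))"
      using zero less.prems by (intro sum.mono_neutral_right) auto
    finally show ?case using md less.prems by simp
  qed
  then show ?thesis using j0 by (simp add: d_def k_def)
qed

text \<open>For \<open>\<kappa> < m\<close>, \<open>X\<close> times the locator has only exponents
  \<open>q ^ s\<close> with \<open>s\<close> even, so it acts as a \<open>K\<close>-linear map. Its
  kernel is the support together with 0, and the cardinality fixes the dimension.\<close>

lemma min_weight_support:
  assumes x: "x \<in> C" "x \<noteq> (\<lambda>_. 0)" "hwt x = q ^ (2 * \<kappa>) - 1"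
  shows "subspace_dim K ({g. g \<noteq> 0 \<and> x g \<noteq> 0} \<union> {0}) \<kappa>"
proof -
  define S where "S = {g. g \<noteq> 0 \<and> x g \<noteq> 0}"
  have cardS: "card S = q ^ (2 * \<kappa>) - 1" using x(3) by (simp add: S_def hwt_def)
  have card: "card (S \<union> {0}) = card K ^ \<kappa>"
    using cardS q_ge_2 by (simp add: S_def card_K power_mult)
  have "subspace_dim K (S \<union> {0}) \<kappa>"
  proof (cases "\<kappa> = m")
    \<comment> \<open>The weight is \<open>q ^ n - 1\<close>, so the support consists of all nonzero
      elements; Newton's identities, which need exponents beyond \<open>q ^ (2 * \<kappa>)\<close>,
      are bypassed.\<close>
    case True
    have "S \<union> {0} = UNIV"
      using card card_UNIV True n by (intro card_subset_eq) (auto simp: card_K power_mult)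
    then show ?thesis using card by (intro K.subspace_dim_of_card) auto
  next
    case False
    then have \<kappa>m: "\<kappa> < m" using \<kappa> by simp
    define L where "L v = (\<Sum>j\<le>card S. coeff (locator S) j * v ^ Suc j)" for v
    have L: "L v = v * poly (locator S) v" for v
      by (simp add: L_def poly_altdef locator_simps sum_distrib_left mult_ac)
    have mem: "v \<in> S \<union> {0} \<longleftrightarrow> L v = 0" for v by (auto simp: L locator_simps)
    have exps: "coeff (locator S) j = 0 \<or> (\<exists>s. even s \<and> Suc j = q ^ s)" if "j \<le> card S" for j
    \<comment> \<open>The leading exponent \<open>q ^ (2 * \<kappa>)\<close> is admissible and lies
      outside the range of \<open>coeff_locator_eq_0\<close>.\<close>
    proof (cases "j = card S")
      case True
      then have "Suc j = q ^ (2 * \<kappa>)" using cardS q_ge_2 by simp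
      then show ?thesis by (intro disjI2 exI[of _ "2 * \<kappa>"]) simp
    next
      case False
      then show ?thesis
        using that coeff_locator_eq_0[OF x \<kappa>m S_def, of j] cardS by auto
    qed
    have L_add: "L (v + w) = L v + L w" for v w
      unfolding L_def sum.distrib[symmetric]
    proof (rule sum.cong)
      fix j assume "j \<in> {..card S}"
      then show "coeff (locator S) j * (v + w) ^ Suc j
          = coeff (locator S) j * v ^ Suc j + coeff (locator S) j * w ^ Suc j"
        using exps[of j] by (auto simp: frobenius_add distrib_left simp del: power_Suc)
    qed simp
    have L_scale: "L (c * v) = c * L v" if c: "c \<in> K" for c v
      unfolding L_def sum_distrib_left
    proof (rule sum.cong)
      fix j assume "j \<in> {..card S}"
      then show "coeff (locator S) j * (c * v) ^ Suc j = c * (coeff (locator S) j * v ^ Suc j)"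
        using exps[of j] K_power[OF c] by (auto simp: power_mult_distrib mult_ac simp del: power_Suc)
    qed simp
    show ?thesis
      by (rule K.subspace_dim_of_card[OF _ _ _ card]) (auto simp only: mem L_add L_scale, auto simp: L_def)
  qed
  then show ?thesis by (simp add: S_def)
qed

lemma min_weight_constant:
  assumes x: "x \<in> C" "x \<noteq> (\<lambda>_. 0)" "hwt x = q ^ (2 * \<kappa>) - 1"
  shows "\<exists>lam\<in>subF q - {0}. \<exists>V. subspace_dim K V \<kappa> \<and>
    (\<forall>g. x g = (if g \<in> V - {0} then lam else 0))"
proof -
  define S where "S = {g. g \<noteq> 0 \<and> x g \<noteq> 0}"
  have x0: "x 0 = 0" using code_0[OF x(1)] .
  obtain g0 where g0: "g0 \<in> S" 
  proof -
    obtain g where "x g \<noteq> 0" using x(2) by blast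
    then show ?thesis using that[of g] x0 unfolding S_def by blast
  qed
  have V: "subspace_dim K (S \<union> {0}) \<kappa>" using min_weight_support[OF x] by (simp add: S_def)
  have one: "1 \<in> subF q" by (simp add: subF_def)
  have lam: "x g0 \<in> subF q" using x(1) by (simp add: code_def)
  \<comment> \<open>The factor \<open>x g0\<close> cancels the coordinate at \<open>g0\<close> and
    creates none outside \<open>S\<close>.\<close>
  define y where "y = (\<lambda>g. x g - x g0 * (if g \<in> S \<union> {0} - {0} then 1 else 0))"
  have "y \<in> C"
    using code_diff_scale[OF x(1) subspace_indicator_in_code[OF V one] lam] by (simp only: y_def)
  moreover have "hwt y < q ^ (2 * \<kappa>) - 1"
  proof -
    have "{g. g \<noteq> 0 \<and> y g \<noteq> 0} \<subset> S" using g0 by (auto simp: y_def S_def split: if_splits)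
    then have "hwt y < card S" unfolding hwt_def by (intro psubset_card_mono) auto
    then show ?thesis using x(3) by (simp add: S_def hwt_def)
  qed
  ultimately have "y = (\<lambda>_. 0)" using min_weight_bound[of y] by force
  then have y0: "y g = 0" for g by simp
  have "x g = (if g \<in> (S \<union> {0}) - {0} then x g0 else 0)" for g
    using y0[of g] x0 by (cases "g \<in> S") (auto simp: y_def S_def)
  moreover have "x g0 \<in> subF q - {0}" using lam g0 by (simp add: S_def)
  ultimately show ?thesis using V by blast
qed

lemma min_wt_codewords_iff:
  "x \<in> min_wt_codewords C \<longleftrightarrow>
    (\<exists>lam\<in>subF q - {0}. \<exists>V. subspace_dim K V \<kappa> \<and> (\<forall>g. x g = (if g \<in> V - {0} then lam else 0)))"
    (is "_ \<longleftrightarrow> ?R")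
proof
  have pos: "0 < q ^ (2 * \<kappa>) - 1"
    using q_ge_2 \<kappa> one_less_power[of q "2 * \<kappa>"] by auto
  have hwt0: "hwt (\<lambda>_. 0 :: 'a) = 0" by (simp add: hwt_def)
  show "x \<in> min_wt_codewords C" if R: ?R
  proof -
    obtain lam V where *: "lam \<in> subF q - {0}" "subspace_dim K V \<kappa>"
      "\<forall>g. x g = (if g \<in> V - {0} then lam else 0)" using R by blast
    then have x_eq: "x = (\<lambda>g. if g \<in> V - {0} then lam else 0)" by blast
    have "hwt x = q ^ (2 * \<kappa>) - 1" using hwt_subspace_indicator[OF *(2)] *(1) unfolding x_eq by blast
    moreover have "x \<in> C" using subspace_indicator_in_code[OF *(2)] *(1) unfolding x_eq by blast
    ultimately show ?thesis
      using min_weight_bound pos hwt0 unfolding min_wt_codewords_def by auto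
  qed
  show ?R if "x \<in> min_wt_codewords C"
  proof -
    have x: "x \<in> C" "x \<noteq> (\<lambda>_. 0)" and min: "\<And>y. y \<in> C \<Longrightarrow> y \<noteq> (\<lambda>_. 0) \<Longrightarrow> hwt x \<le> hwt y"
      using that unfolding min_wt_codewords_def by auto
    \<comment> \<open>An indicator of some subspace attains the lower bound, so the minimum weight
      is exactly \<open>q ^ (2 * \<kappa>) - 1\<close>.\<close>
    obtain V where V: "subspace_dim K V \<kappa>" using ex_subspace[OF \<kappa>(2)] by blast
    let ?y = "\<lambda>g. if g \<in> V - {0} then 1 else 0 :: 'a"
    have y: "hwt ?y = q ^ (2 * \<kappa>) - 1" "?y \<in> C"
      using hwt_subspace_indicator[OF V, of 1] subspace_indicator_in_code[OF V, of 1]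
      by (simp_all add: subF_def)
    then have "?y \<noteq> (\<lambda>_. 0)" using pos hwt0 by (metis less_irrefl)
    then have "hwt x = q ^ (2 * \<kappa>) - 1"
      using min[OF y(2)] y(1) min_weight_bound[OF x] by simp
    then show ?thesis using min_weight_constant[OF x] by blast
  qed
qed

end

theorem theorem5p6:
  fixes \<alpha> :: "'a::{field,finite}" and x :: "'a \<Rightarrow> 'a"
    and p l q m n \<rho> \<rho>' r :: nat and I :: "nat set"
  assumes "prime p" and "l \<ge> 1" and "q = p ^ l"
    and "m \<ge> 1" and "n = 2 * m"
    and "card (UNIV :: 'a set) = q ^ n"
    and "primitive \<alpha>"
    and "r = \<rho> * (q - 1)" and "\<rho> \<le> n - 1" and "\<rho> = 2 * \<rho>'"
    and "I \<subseteq> Mset q m r" and "0 \<in> I" and "2 \<notin> I"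
  shows "x \<in> min_wt_codewords (code q n \<alpha> r I) \<longleftrightarrow>
    (\<exists>lam\<in>subF q - {0}. \<exists>V. subspace_dim (subF (q ^ 2)) V (m - \<rho>') \<and>
       (\<forall>g. x g = (if g \<in> V - {0} then lam else 0)))"
proof -
  \<comment> \<open>From \<open>2 * \<rho>' \<le> 2 * m - 1\<close>, the dimension
    \<open>m - \<rho>'\<close> is at least 1.\<close>
  have \<rho>': "\<rho>' < m" using assms(4,5,9,10) by linarith
  interpret even_degree_code q m n \<alpha> r "m - \<rho>'" I
  proof
    show "\<exists>p l. prime p \<and> l \<ge> 1 \<and> q = p ^ l" using assms(1-3) by blast
    show "r = 2 * (m - (m - \<rho>')) * (q - 1)" using assms(8,10) \<rho>' by simp
  qed (use assms \<rho>' in auto)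
  show ?thesis by (rule min_wt_codewords_iff)
qed

end
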